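(* There exists a constant $c>0$ such that for every integer $k \geq 1$ there exists an undirected graph $G$ of pathwidth at most $k$ with at most $k^{c}$ vertices such that every tropical circuit calculating $IS_G$ has $\Omega(2^k)$ gates (nodes).
   Context: For an undirected graph $G$, associate a variable $x_v$ with every vertex $v$, and let $\mathcal{I}(G)$ be the family of independent sets of $G$. $IS_G$ is the tropical $(\max,+)$ polynomial $\sum_{I \in \mathcal{I}(G)} \prod_{v\in I} x_v$; for a valuation $\nu$ (an assignment of real numbers to the variables) it evaluates to $IS_G(\nu)=\max_{I\in\mathcal{I}(G)}\sum_{v\in I}\nu(x_v)$. A tropical circuit is a directed acyclic graph whose nodes have in-degree $0$ or $2$; in-degree-$0$ nodes are labeled by a variable (input nodes) or by the constant $0$; in-degree-$2$ nodes are labeled by $+$ or $\max$; one node is designated as output. On a valuation $\nu$, an input node labeled $x$ evaluates to $\nu(x)$, a constant node to $0$, and a $+$ (resp. $\max$) node to the sum (resp. maximum) of the values of its two predecessors; the circuit's value is that of the output node. A circuit calculates a polynomial $p$ if its value equals $p(\nu)$ for every valuation $\nu$. The size (number of gates) of a circuit is its number of nodes. A path decomposition of $G$ is a sequence of bags $\beta_1,\dots,\beta_\ell\subseteq V(G)$ such that every edge lies in some bag and, for each vertex, the bags containing it form a contiguous interval; its width is $\max_i|\beta_i|-1$, and the pathwidth is the minimum width of a path decomposition. *)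

theory Defs
  imports Complex_Main "HOL-Library.Multiset" "Graph_Theory.Pair_Digraph"
begin

text \<open>
  Finite simple undirected graphs are the graphs \<open>G\<close> with \<^locale>\<open>pair_graph\<close>: finite, loopfree
  digraphs whose arc relation \<open>parcs G\<close> is symmetric.
\<close>

definition independent_sets :: "'v pair_pre_digraph \<Rightarrow> 'v set set" where
  "independent_sets G = {I. I \<subseteq> pverts G \<and> (\<forall>u\<in>I. \<forall>v\<in>I. (u, v) \<notin> parcs G)}"

definition path_decomposition :: "'v pair_pre_digraph \<Rightarrow> 'v set list \<Rightarrow> bool" where
  "path_decomposition G bs \<longleftrightarrow>
     bs \<noteq> [] \<and>
     (\<forall>B \<in> set bs. B \<subseteq> pverts G) \<and>
     (\<forall>(u, v) \<in> parcs G. \<exists>B \<in> set bs. u \<in> B \<and> v \<in> B) \<and>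
     (\<forall>v \<in> pverts G. \<exists>i j. i \<le> j \<and> j < length bs \<and>
        {l. l < length bs \<and> v \<in> bs ! l} = {i..j})"

text \<open>
  Widths are integers because the decomposition into empty bags of the graph without vertices
  has width \<open>-1\<close>.
\<close>

definition pd_width :: "'v set list \<Rightarrow> int" where
  "pd_width bs = Max ((\<lambda>B. int (card B)) ` set bs) - 1"

definition pathwidth :: "'v pair_pre_digraph \<Rightarrow> int" where
  "pathwidth G = Min (pd_width ` {bs. path_decomposition G bs})"

text \<open>
  A monomial is the multiset of its variables, and a tropical polynomial is given by its monomials,
  all of which have the coefficient \<open>0\<close>, the unit of tropical multiplication. The variable
  \<open>x\<^sub>v\<close> of a graph is identified with the vertex \<open>v\<close>.
\<close>

type_synonym 'v tropical_poly = "'v multiset set"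

definition tropical_eval :: "'v tropical_poly \<Rightarrow> ('v \<Rightarrow> real) \<Rightarrow> real" where
  "tropical_eval P \<nu> = Max ((\<lambda>m. \<Sum>x\<in>#m. \<nu> x) ` P)"

definition IS_poly :: "'v pair_pre_digraph \<Rightarrow> 'v tropical_poly" where
  "IS_poly G = mset_set ` independent_sets G"

datatype ('v, 'n) gate =
    Input 'v
  | Zero
  | Plus_gate 'n 'n
  | Max_gate 'n 'n

fun preds :: "('v, 'n) gate \<Rightarrow> 'n set" where
  "preds (Input x) = {}"
| "preds Zero = {}"
| "preds (Plus_gate u w) = {u, w}"
| "preds (Max_gate u w) = {u, w}"

record ('v, 'n) circuit =
  nodes :: "'n set"
  gate :: "'n \<Rightarrow> ('v, 'n) gate"
  out_node :: 'n

definition wires :: "('v, 'n) circuit \<Rightarrow> 'n rel" where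
  "wires C = {(u, w). w \<in> nodes C \<and> u \<in> preds (gate C w)}"

text \<open>
  The two predecessors of a node may coincide, which stands for a pair of parallel arcs.
\<close>

definition tropical_circuit :: "'v set \<Rightarrow> ('v, 'n) circuit \<Rightarrow> bool" where
  "tropical_circuit X C \<longleftrightarrow>
     finite (nodes C) \<and> out_node C \<in> nodes C \<and>
     (\<forall>w \<in> nodes C. preds (gate C w) \<subseteq> nodes C) \<and>
     acyclic (wires C) \<and>
     (\<forall>w \<in> nodes C. \<forall>x. gate C w = Input x \<longrightarrow> x \<in> X)"

definition circuit_size :: "('v, 'n) circuit \<Rightarrow> nat" where
  "circuit_size C = card (nodes C)"

inductive node_value :: "('v, 'n) circuit \<Rightarrow> ('v \<Rightarrow> real) \<Rightarrow> 'n \<Rightarrow> real \<Rightarrow> bool"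
  for C \<nu> where
  Input: "gate C w = Input x \<Longrightarrow> node_value C \<nu> w (\<nu> x)"
| Zero: "gate C w = Zero \<Longrightarrow> node_value C \<nu> w 0"
| Plus: "gate C w = Plus_gate u u' \<Longrightarrow> node_value C \<nu> u a \<Longrightarrow> node_value C \<nu> u' b
          \<Longrightarrow> node_value C \<nu> w (a + b)"
| Max: "gate C w = Max_gate u u' \<Longrightarrow> node_value C \<nu> u a \<Longrightarrow> node_value C \<nu> u' b
          \<Longrightarrow> node_value C \<nu> w (max a b)"

lemma node_value_unique:
  "node_value C \<nu> w a \<Longrightarrow> node_value C \<nu> w b \<Longrightarrow> a = b"
proof (induction arbitrary: b rule: node_value.induct)
  case (Plus w u u' a a')
  from Plus.prems obtain c c' where "node_value C \<nu> u c" "node_value C \<nu> u' c'" "b = c + c'"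
    by cases (simp_all add: Plus.hyps)
  then show ?case using Plus.IH by simp
next
  case (Max w u u' a a')
  from Max.prems obtain c c' where "node_value C \<nu> u c" "node_value C \<nu> u' c'" "b = max c c'"
    by cases (simp_all add: Max.hyps)
  then show ?case using Max.IH by simp
qed (erule node_value.cases; simp)+

lemma node_value_ex1:
  assumes C: "tropical_circuit X C" and w: "w \<in> nodes C"
  shows "\<exists>!a. node_value C \<nu> w a"
proof -
  have "wires C \<subseteq> nodes C \<times> nodes C" and fin: "finite (nodes C)"
    using C by (auto simp: tropical_circuit_def wires_def)
  then have "finite (wires C)"
    by (meson finite_SigmaI finite_subset)
  moreover have "acyclic (wires C)"
    using C by (simp add: tropical_circuit_def)
  ultimately have "wf (wires C)"
    by (rule finite_acyclic_wf)
  then have "\<exists>a. node_value C \<nu> w a"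
    using w
  proof (induction w rule: wf_induct_rule)
    case (less w)
    have IH: "\<exists>a. node_value C \<nu> u a" if "u \<in> preds (gate C w)" for u
      using that less C by (auto simp: tropical_circuit_def wires_def)
    show ?case
    proof (cases "gate C w")
      case (Plus_gate u u')
      then show ?thesis using IH[of u] IH[of u'] by (auto intro: node_value.Plus)
    next
      case (Max_gate u u')
      then show ?thesis using IH[of u] IH[of u'] by (auto intro: node_value.Max)
    qed (auto intro: node_value.Input node_value.Zero)
  qed
  then show ?thesis
    by (auto intro: node_value_unique)
qed

definition circuit_value :: "('v, 'n) circuit \<Rightarrow> ('v \<Rightarrow> real) \<Rightarrow> real" where
  "circuit_value C \<nu> = (THE a. node_value C \<nu> (out_node C) a)"

definition calculates :: "('v, 'n) circuit \<Rightarrow> 'v tropical_poly \<Rightarrow> bool" where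
  "calculates C P \<longleftrightarrow> (\<forall>\<nu>. circuit_value C \<nu> = tropical_eval P \<nu>)"

end

theory Submission
  imports Defs "HOL-Library.Countable"
begin

text \<open>
  A circuit computing \<open>IS_G\<close> formally produces exactly the independent sets of \<open>G\<close> as monomials.
  For a node \<open>w\<close>, let \<open>A\<close> be the variables of the monomials at \<open>w\<close> and \<open>B\<close> those of the factors
  by which they are multiplied on the way to the output. Then \<open>A\<close> and \<open>B\<close> are disjoint without
  arcs between them, and descending from the output to the heavier factor yields for every
  independent set \<open>I\<close> a node with \<open>I \<subseteq> A \<union> B\<close> such that \<open>A\<close> and \<open>B\<close> both
  contain at least a third of the weight of \<open>I\<close>.

  It remains to find many independent sets of which each such separation catches few. Take \<open>k\<close> long paths
  \<open>P p\<close> and \<open>n = 9 k\<close> transversal paths \<open>Q j\<close>, with a connecting vertex \<open>R p j\<close> for each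
  pair. Bits for all paths select one of the two colour classes of each path, and \<open>R p j\<close> is added
  if both its bits are one. Say that a separation hits the vertices outside \<open>A \<union> B\<close>. Either each
  \<open>P p\<close> is hit itself or at many of its connectors, or the separation is unbalanced or hits \<open>k\<close>
  of the \<open>Q j\<close>.
  Avoiding the hit vertices has probability \<open>O(2\<^sup>-\<^sup>k)\<close> in each case. The pathwidth is \<open>k + O(1)\<close>.
\<close>

section \<open>Monomials of tropical circuits\<close>

lemma independent_setsD:
  "I \<in> independent_sets G \<Longrightarrow> I \<subseteq> pverts G"
  "I \<in> independent_sets G \<Longrightarrow> u \<in> I \<Longrightarrow> v \<in> I \<Longrightarrow> (u, v) \<notin> parcs G"
  by (auto simp: independent_sets_def)

lemma finite_independent_sets:
  assumes "finite (pverts G)"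
  shows "finite (independent_sets G)"
  by (rule finite_subset[of _ "Pow (pverts G)"]) (use assms in \<open>auto simp: independent_sets_def\<close>)

lemma tropical_eval_IS_poly:
  "tropical_eval (IS_poly G) \<nu> = Max ((\<lambda>I. sum \<nu> I) ` independent_sets G)"
  by (simp add: tropical_eval_def IS_poly_def image_image sum_unfold_sum_mset)

inductive node_monomial :: "('v, 'n) circuit \<Rightarrow> 'n \<Rightarrow> 'v multiset \<Rightarrow> bool" for C where
  Input: "gate C w = Input x \<Longrightarrow> node_monomial C w {#x#}"
| Zero: "gate C w = Zero \<Longrightarrow> node_monomial C w {#}"
| Plus: "gate C w = Plus_gate u u' \<Longrightarrow> node_monomial C u a \<Longrightarrow> node_monomial C u' b
          \<Longrightarrow> node_monomial C w (a + b)"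
| Max1: "gate C w = Max_gate u u' \<Longrightarrow> node_monomial C u a \<Longrightarrow> node_monomial C w a"
| Max2: "gate C w = Max_gate u u' \<Longrightarrow> node_monomial C u' a \<Longrightarrow> node_monomial C w a"

text \<open>
  The factors by which the monomials of a node may be multiplied on the way to the output.
\<close>

inductive node_cofactor :: "('v, 'n) circuit \<Rightarrow> 'n \<Rightarrow> 'v multiset \<Rightarrow> bool" for C where
  Out: "node_cofactor C (out_node C) {#}"
| Plus1: "node_cofactor C w b \<Longrightarrow> gate C w = Plus_gate u u' \<Longrightarrow> node_monomial C u' a
          \<Longrightarrow> node_cofactor C u (a + b)"
| Plus2: "node_cofactor C w b \<Longrightarrow> gate C w = Plus_gate u u' \<Longrightarrow> node_monomial C u a
          \<Longrightarrow> node_cofactor C u' (a + b)"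
| Max1: "node_cofactor C w b \<Longrightarrow> gate C w = Max_gate u u' \<Longrightarrow> node_cofactor C u b"
| Max2: "node_cofactor C w b \<Longrightarrow> gate C w = Max_gate u u' \<Longrightarrow> node_cofactor C u' b"

lemma node_cofactor_monomial:
  assumes "node_cofactor C w b" and "node_monomial C w a"
  shows "node_monomial C (out_node C) (a + b)"
  using assms
proof (induction arbitrary: a rule: node_cofactor.induct)
  case (Plus1 w b u u' a')
  then have "node_monomial C w (a + a')"
    by (auto intro: node_monomial.Plus)
  then show ?case
    using Plus1.IH by (fastforce simp: add.assoc)
next
  case (Plus2 w b u u' a')
  then have "node_monomial C w (a' + a)"
    by (auto intro: node_monomial.Plus)
  then have "node_monomial C (out_node C) (a' + a + b)"
    by (rule Plus2.IH)
  then show ?case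
    by (simp add: ac_simps)
qed (auto intro: node_monomial.intros)

lemma node_cofactor_in_nodes:
  assumes "tropical_circuit X C" and "node_cofactor C w b"
  shows "w \<in> nodes C"
  using assms(2)
proof (induction rule: node_cofactor.induct)
  case Out
  then show ?case
    using assms(1) by (simp add: tropical_circuit_def)
qed (use assms(1) in \<open>unfold tropical_circuit_def, fastforce\<close>)+

text \<open>Stated as attainment plus an upper bound, because a maximum taken with
  \<open>Max\<close> would first require that a node has finitely many monomials.\<close>

lemma node_value_monomials:
  assumes "node_value C \<nu> w r"
  shows "(\<exists>m. node_monomial C w m \<and> (\<Sum>x\<in>#m. \<nu> x) = r)
    \<and> (\<forall>m. node_monomial C w m \<longrightarrow> (\<Sum>x\<in>#m. \<nu> x) \<le> r)"
  using assms
proof (induction rule: node_value.induct)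
  case (Input w x)
  then show ?case
    by (auto intro!: exI[of _ "{#x#}"] node_monomial.Input elim: node_monomial.cases)
next
  case (Zero w)
  then show ?case
    by (auto intro!: exI[of _ "{#}"] node_monomial.Zero elim: node_monomial.cases)
next
  case (Plus w u u' a b)
  from Plus.IH obtain m m' where "node_monomial C u m" "node_monomial C u' m'"
    "(\<Sum>x\<in>#m. \<nu> x) = a" "(\<Sum>x\<in>#m'. \<nu> x) = b"
    by blast
  then have "node_monomial C w (m + m')" "(\<Sum>x\<in>#m + m'. \<nu> x) = a + b"
    using Plus.hyps by (auto intro: node_monomial.Plus)
  moreover have "(\<Sum>x\<in>#m. \<nu> x) \<le> a + b" if "node_monomial C w m" for m
    using that Plus.hyps Plus.IH by cases (auto intro: add_mono)
  ultimately show ?case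
    by blast
next
  case (Max w u u' a b)
  from Max.IH obtain m m' where m: "node_monomial C u m" "node_monomial C u' m'"
    "(\<Sum>x\<in>#m. \<nu> x) = a" "(\<Sum>x\<in>#m'. \<nu> x) = b"
    by blast
  then have "node_monomial C w m" "node_monomial C w m'"
    using Max.hyps by (auto intro: node_monomial.Max1 node_monomial.Max2)
  then have "\<exists>m. node_monomial C w m \<and> (\<Sum>x\<in>#m. \<nu> x) = max a b"
    using m by (cases "a \<le> b") (auto simp: max_def)
  moreover have "(\<Sum>x\<in>#m. \<nu> x) \<le> max a b" if "node_monomial C w m" for m
    using that Max.hyps Max.IH by cases (auto simp: le_max_iff_disj)
  ultimately show ?case
    by blast
qed

lemma circuit_value_monomials:
  assumes "tropical_circuit X C"
  shows "\<exists>m. node_monomial C (out_node C) m \<and> (\<Sum>x\<in>#m. \<nu> x) = circuit_value C \<nu>"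
    and "node_monomial C (out_node C) m \<Longrightarrow> (\<Sum>x\<in>#m. \<nu> x) \<le> circuit_value C \<nu>"
proof -
  have "out_node C \<in> nodes C"
    using assms by (simp add: tropical_circuit_def)
  then have "node_value C \<nu> (out_node C) (circuit_value C \<nu>)"
    unfolding circuit_value_def by (rule theI'[OF node_value_ex1[OF assms]])
  from node_value_monomials[OF this]
  show "\<exists>m. node_monomial C (out_node C) m \<and> (\<Sum>x\<in>#m. \<nu> x) = circuit_value C \<nu>"
    and "node_monomial C (out_node C) m \<Longrightarrow> (\<Sum>x\<in>#m. \<nu> x) \<le> circuit_value C \<nu>"
    by blast+
qed

lemma sum_mset_indicator:
  "(\<Sum>x\<in>#m. if x = v then 1 else 0) = real (count m v)"
  by (induction m) auto

text \<open>Weight +1 on \<open>I\<close> and -1 off it penalises foreign variables, so a squarefree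
  monomial reaches the weight of \<open>I\<close> only by containing all of \<open>I\<close> and
  nothing else.\<close>

lemma sum_mset_signed_indicator_eq_card:
  fixes m :: "'v multiset"
  assumes "finite I" and "\<And>v. count m v \<le> 1"
    and "(\<Sum>x\<in>#m. if x \<in> I then 1 else - 1) = real (card I)"
  shows "m = mset_set I"
proof -
  define M where "M = set_mset m"
  have m: "m = mset_set M"
  proof (rule multiset_eqI)
    fix v
    show "count m v = count (mset_set M) v"
      using assms(2)[of v] by (cases "v \<in># m") (auto simp: M_def count_mset_set' le_Suc_eq count_eq_zero_iff)
  qed
  have fin: "finite M"
    by (simp add: M_def)
  have "(\<Sum>x\<in>#m. if x \<in> I then 1 else - 1) = (\<Sum>x\<in>M. if x \<in> I then 1 else - 1 :: real)"
    by (simp add: m sum_unfold_sum_mset)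
  also have "\<dots> = real (card (M \<inter> I)) - real (card (M - I))"
    using fin by (simp add: sum.If_cases Diff_eq Collect_neg_eq)
  finally have eq: "real (card (M \<inter> I)) - real (card (M - I)) = real (card I)"
    using assms(3) by simp
  moreover have "card (M \<inter> I) \<le> card I"
    by (rule card_mono) (auto simp: assms(1))
  ultimately have "card (M - I) = 0" and card_eq: "card (M \<inter> I) = card I"
    by linarith+
  then have "M - I = {}"
    using fin by simp
  moreover have "M \<inter> I = I"
    by (rule card_subset_eq[OF assms(1) Int_lower2 card_eq])
  ultimately have "M = I"
    by blast
  then show ?thesis
    using m by simp
qed

section \<open>Test valuations for the polynomial of independent sets\<close>

context
  fixes G :: "'v pair_pre_digraph" and C :: "('v, 'n) circuit"
  assumes G: "pair_graph G"
    and C: "tropical_circuit (pverts G) C"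
    and calc: "calculates C (IS_poly G)"
begin

interpretation pair_graph G
  by (rule G)

lemma circuit_value_le:
  assumes "\<And>I. I \<in> independent_sets G \<Longrightarrow> sum \<nu> I \<le> r"
  shows "circuit_value C \<nu> \<le> r"
proof -
  have "{} \<in> independent_sets G"
    by (simp add: independent_sets_def)
  then have "Max ((\<lambda>I. sum \<nu> I) ` independent_sets G) \<le> r"
    using assms finite_independent_sets[OF pair_finite_verts] by (subst Max_le_iff) auto
  then show ?thesis
    using calc by (simp add: calculates_def tropical_eval_IS_poly)
qed

lemma sum_le_circuit_value:
  assumes "I \<in> independent_sets G"
  shows "sum \<nu> I \<le> circuit_value C \<nu>"
  using assms calc finite_independent_sets[OF pair_finite_verts]
  by (simp add: calculates_def tropical_eval_IS_poly)

text \<open>At the indicator of \<open>v\<close>, independent sets weigh at most 1, whereas a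
  monomial weighs its multiplicity of \<open>v\<close>.\<close>

lemma monomial_count_le_1:
  assumes "node_monomial C (out_node C) m"
  shows "count m v \<le> 1"
proof -
  let ?\<nu> = "\<lambda>x. if x = v then 1 else 0 :: real"
  have "sum ?\<nu> I \<le> 1" if "I \<in> independent_sets G" for I
    using finite_subset[OF independent_setsD(1)[OF that] pair_finite_verts] by simp
  then have "circuit_value C ?\<nu> \<le> 1"
    by (rule circuit_value_le)
  then have "(\<Sum>x\<in>#m. ?\<nu> x) \<le> 1"
    using circuit_value_monomials(2)[OF C assms] by (rule order_trans[rotated])
  then show ?thesis
    by (simp add: sum_mset_indicator)
qed

text \<open>At the sum of the indicators of both ends of an arc, independent sets still weigh at
  most 1, but a monomial with both ends would weigh at least 2.\<close>

lemma monomial_no_edge: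
  assumes "node_monomial C (out_node C) m" and "u \<in># m" and "v \<in># m"
  shows "(u, v) \<notin> parcs G"
proof
  assume uv: "(u, v) \<in> parcs G"
  then have "u \<noteq> v"
    using pair_no_loops by fastforce
  let ?\<nu> = "\<lambda>x. (if x = u then 1 else 0) + (if x = v then 1 else 0 :: real)"
  have "sum ?\<nu> I \<le> 1" if I: "I \<in> independent_sets G" for I
    using finite_subset[OF independent_setsD(1)[OF that] pair_finite_verts]
      independent_setsD(2)[OF I, of u v] uv by (auto simp: sum.distrib)
  then have "circuit_value C ?\<nu> \<le> 1"
    by (rule circuit_value_le)
  then have "(\<Sum>x\<in>#m. ?\<nu> x) \<le> 1"
    using circuit_value_monomials(2)[OF C assms(1)] by (rule order_trans[rotated])
  then have "count m u + count m v \<le> 1"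
    by (simp add: sum_mset.distrib sum_mset_indicator)
  then show False
    using assms(2,3) by (simp add: Suc_le_eq flip: count_greater_zero_iff)
qed

text \<open>With weight +1 on \<open>I\<close> and -1 elsewhere, the maximum over independent sets
  is the size of \<open>I\<close>. Some monomial attains it, and being squarefree it can only be
  \<open>I\<close>.\<close>

lemma independent_set_is_monomial:
  assumes I: "I \<in> independent_sets G"
  shows "node_monomial C (out_node C) (mset_set I)"
proof -
  let ?\<nu> = "\<lambda>x. if x \<in> I then 1 else - 1 :: real"
  have fin: "finite J" if "J \<in> independent_sets G" for J
    using finite_subset[OF independent_setsD(1)[OF that] pair_finite_verts] .
  have le: "sum ?\<nu> J \<le> real (card I)" if J: "J \<in> independent_sets G" for J
  proof -
    have "sum ?\<nu> J \<le> (\<Sum>x\<in>J. if x \<in> I then 1 else 0)"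
      by (rule sum_mono) auto
    also have "\<dots> = real (card (J \<inter> I))"
      using fin[OF J] by (simp add: sum.If_cases)
    also have "\<dots> \<le> real (card I)"
      using fin[OF I] by (simp add: card_mono)
    finally show ?thesis .
  qed
  have "circuit_value C ?\<nu> = real (card I)"
    using circuit_value_le[OF le] sum_le_circuit_value[OF I, of ?\<nu>] by simp
  then obtain m where m: "node_monomial C (out_node C) m" "(\<Sum>x\<in>#m. ?\<nu> x) = real (card I)"
    using circuit_value_monomials(1)[OF C, of ?\<nu>] by auto
  then have "m = mset_set I"
    using sum_mset_signed_indicator_eq_card[OF fin[OF I]] monomial_count_le_1 by blast
  then show ?thesis
    using m by simp
qed

end

section \<open>Balanced separations from circuit nodes\<close>

text \<open>The heavier factor at a sum gate keeps at least half of the weight, so the first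
  monomial of weight at most 2N/3 on the descent still has more than N/3. Discarded factors move
  into the cofactor, which preserves the product.\<close>

lemma balanced_node:
  assumes "node_monomial C w a" and "node_cofactor C w b"
    and "2 * N < 3 * size (filter_mset P a)" and "2 \<le> N"
  shows "\<exists>w' a' b'. node_monomial C w' a' \<and> node_cofactor C w' b' \<and> a' + b' = a + b
    \<and> N < 3 * size (filter_mset P a') \<and> 3 * size (filter_mset P a') \<le> 2 * N"
  using assms(1-3)
proof (induction arbitrary: b rule: node_monomial.induct)
  case (Input w x)
  \<comment> \<open>A single variable cannot weigh more than 2N/3 once N is at least 2, so the
    descent stops before reaching an input.\<close>
  have "size (filter_mset P {#x#}) \<le> 1"
    by simp
  then show ?case
    using Input.prems \<open>2 \<le> N\<close> by linarith
next
  case (Plus w u u' a a')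
  have cof: "node_cofactor C u (a' + b)" "node_cofactor C u' (a + b)"
    using Plus.hyps Plus.prems by (auto intro: node_cofactor.intros)
  have "N < 3 * size (filter_mset P a) \<or> N < 3 * size (filter_mset P a')"
    using Plus.prems by auto
  then show ?case
  proof
    assume *: "N < 3 * size (filter_mset P a)"
    show ?case
    proof (cases "3 * size (filter_mset P a) \<le> 2 * N")
      case True
      then show ?thesis
        using * cof Plus.hyps by (intro exI[of _ u] exI[of _ a] exI[of _ "a' + b"]) (simp add: ac_simps)
    next
      case False
      then show ?thesis
        using Plus.IH(1)[OF cof(1)] by (simp add: ac_simps)
    qed
  next
    assume *: "N < 3 * size (filter_mset P a')"
    show ?case
    proof (cases "3 * size (filter_mset P a') \<le> 2 * N")
      case True
      then show ?thesis
        using * cof Plus.hyps by (intro exI[of _ u'] exI[of _ a'] exI[of _ "a + b"]) (simp add: ac_simps)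
    next
      case False
      then show ?thesis
        using Plus.IH(2)[OF cof(2)] by (simp add: ac_simps)
    qed
  qed
next
  case (Max1 w u u' a)
  then show ?case
    using Max1.IH[OF node_cofactor.Max1[OF Max1.prems(1) Max1.hyps(1)]] by simp
next
  case (Max2 w u u' a)
  then show ?case
    using Max2.IH[OF node_cofactor.Max2[OF Max2.prems(1) Max2.hyps(1)]] by simp
qed simp

text \<open>
  A node yields the separation formed by the variables of its monomials and those of its cofactors:
  every monomial times every cofactor is an independent set. Each \<open>I \<omega>\<close> lies inside the balanced
  separation of some node.
\<close>

lemma circuit_size_ge_of_separations:
  fixes G :: "'v pair_pre_digraph" and C :: "('v, 'n) circuit"
  assumes G: "pair_graph G"
    and C: "tropical_circuit (pverts G) C"
    and calc: "calculates C (IS_poly G)"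
    and fin: "finite \<Omega>"
    and indep: "\<And>\<omega>. \<omega> \<in> \<Omega> \<Longrightarrow> I \<omega> \<in> independent_sets G"
    and weight: "\<And>\<omega>. \<omega> \<in> \<Omega> \<Longrightarrow> card (I \<omega> \<inter> W) = N"
    and N: "2 \<le> N"
    and sep: "\<And>A B. A \<inter> B = {} \<Longrightarrow> (\<And>u v. u \<in> A \<Longrightarrow> v \<in> B \<Longrightarrow> (u, v) \<notin> parcs G) \<Longrightarrow>
      card {\<omega> \<in> \<Omega>. I \<omega> \<subseteq> A \<union> B \<and> N \<le> 3 * card (I \<omega> \<inter> W \<inter> A) \<and> N \<le> 3 * card (I \<omega> \<inter> W \<inter> B)} \<le> M"
  shows "card \<Omega> \<le> circuit_size C * M"
proof -
  \<comment> \<open>Both sides collect variables over all monomials and cofactors of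
    \<open>w\<close>, so the separation depends on the node alone and a union bound over the nodes
    applies.\<close>
  define A where "A w = {v. \<exists>a. node_monomial C w a \<and> v \<in># a}" for w
  define B where "B w = {v. \<exists>b. node_cofactor C w b \<and> v \<in># b}" for w
  define S where "S w = {\<omega> \<in> \<Omega>. I \<omega> \<subseteq> A w \<union> B w \<and> N \<le> 3 * card (I \<omega> \<inter> W \<inter> A w)
    \<and> N \<le> 3 * card (I \<omega> \<inter> W \<inter> B w)}" for w
  have disj: "A w \<inter> B w = {}" for w
  proof (rule ccontr)
    assume "A w \<inter> B w \<noteq> {}"
    then obtain v a b where v: "node_monomial C w a" "node_cofactor C w b" "v \<in># a" "v \<in># b"
      by (auto simp: A_def B_def)
    then have "count (a + b) v \<le> 1"
      using monomial_count_le_1[OF G C calc node_cofactor_monomial] by blast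
    then show False
      using v(3,4) by (simp add: Suc_le_eq flip: count_greater_zero_iff)
  qed
  have no_edge: "(u, v) \<notin> parcs G" if uv: "u \<in> A w" "v \<in> B w" for u v w
  proof -
    obtain a b where ab: "node_monomial C w a" "node_cofactor C w b" "u \<in># a" "v \<in># b"
      using uv by (auto simp: A_def B_def)
    show ?thesis
      using monomial_no_edge[OF G C calc node_cofactor_monomial[OF ab(2,1)], of u v] ab(3,4) by simp
  qed
  have "\<Omega> \<subseteq> (\<Union>w\<in>nodes C. S w)"
  proof
    fix \<omega> assume \<omega>: "\<omega> \<in> \<Omega>"
    let ?W = "\<lambda>v. v \<in> W"
    have finI: "finite (I \<omega>)"
      using finite_subset[OF independent_setsD(1)[OF indep[OF \<omega>]]] G
      by (auto simp: pair_graph_def pair_digraph_def pair_fin_digraph_def pair_fin_digraph_axioms_def)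
    have wt: "size (filter_mset ?W (mset_set (I \<omega>))) = N"
      using weight[OF \<omega>] finI by (simp flip: Int_def)
    have mono: "node_monomial C (out_node C) (mset_set (I \<omega>))"
      by (rule independent_set_is_monomial[OF G C calc indep[OF \<omega>]])
    obtain w a b where w: "node_monomial C w a" "node_cofactor C w b" "a + b = mset_set (I \<omega>)"
      "N < 3 * size (filter_mset ?W a)" "3 * size (filter_mset ?W a) \<le> 2 * N"
      using balanced_node[OF mono node_cofactor.Out, of N ?W] wt N by auto
    have "size (filter_mset ?W a) + size (filter_mset ?W b) = N"
      using arg_cong[OF w(3), of "\<lambda>m. size (filter_mset ?W m)"] wt by simp
    then have size_b: "N \<le> 3 * size (filter_mset ?W b)"
      using w(5) by linarith
    have size_le: "size (filter_mset ?W m) \<le> card (I \<omega> \<inter> W \<inter> X)"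
      if "m \<subseteq># mset_set (I \<omega>)" "set_mset m \<subseteq> X" for m X
    proof -
      have "filter_mset ?W m \<subseteq># filter_mset ?W (filter_mset (\<lambda>v. v \<in> X) (mset_set (I \<omega>)))"
      proof (rule multiset_filter_mono)
        have "filter_mset (\<lambda>v. v \<in> X) m = m"
          using that(2) by (auto simp: filter_mset_eq_conv)
        then show "m \<subseteq># filter_mset (\<lambda>v. v \<in> X) (mset_set (I \<omega>))"
          using multiset_filter_mono[OF that(1), of "\<lambda>v. v \<in> X"] by simp
      qed
      then have "size (filter_mset ?W m)
          \<le> size (filter_mset ?W (filter_mset (\<lambda>v. v \<in> X) (mset_set (I \<omega>))))"
        by (rule size_mset_mono)
      also have "\<dots> = card {v \<in> I \<omega>. v \<in> X \<and> v \<in> W}"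
        using finI by (simp add: filter_filter_mset)
      also have "{v \<in> I \<omega>. v \<in> X \<and> v \<in> W} = I \<omega> \<inter> W \<inter> X"
        by auto
      finally show ?thesis .
    qed
    have ab: "set_mset a \<subseteq> A w" "set_mset b \<subseteq> B w"
      using w(1,2) by (auto simp: A_def B_def)
    have "I \<omega> = set_mset (a + b)"
      using w(3) finI by simp
    then have "I \<omega> \<subseteq> A w \<union> B w"
      using ab by auto
    moreover have "a \<subseteq># mset_set (I \<omega>)" "b \<subseteq># mset_set (I \<omega>)"
      unfolding w(3)[symmetric] by simp_all
    then have "N \<le> 3 * card (I \<omega> \<inter> W \<inter> A w)" "N \<le> 3 * card (I \<omega> \<inter> W \<inter> B w)"
      using size_le[of a "A w"] size_le[of b "B w"] ab w(4) size_b by linarith+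
    ultimately have "\<omega> \<in> S w"
      using \<omega> by (simp add: S_def)
    then show "\<omega> \<in> (\<Union>w\<in>nodes C. S w)"
      using node_cofactor_in_nodes[OF C w(2)] by blast
  qed
  moreover have "finite (nodes C)"
    using C by (simp add: tropical_circuit_def)
  moreover have "finite (S w)" for w
    using fin by (simp add: S_def)
  ultimately have "card \<Omega> \<le> card (\<Union>w\<in>nodes C. S w)"
    by (intro card_mono) auto
  also have "\<dots> \<le> (\<Sum>w\<in>nodes C. card (S w))"
    by (rule card_UN_le) fact
  also have "\<dots> \<le> (\<Sum>w\<in>nodes C. M)"
    unfolding S_def by (intro sum_mono sep disj no_edge)
  finally show ?thesis
    by (simp add: circuit_size_def)
qed

section \<open>Interval representations and pathwidth\<close>

text \<open>\<open>Min\<close> needs a finite set. Lists of bags can be arbitrarily long, but their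
  widths lie between -1 and the number of vertices.\<close>

lemma pathwidth_le_pd_width:
  assumes "finite (pverts G)" and "path_decomposition G bs"
  shows "pathwidth G \<le> pd_width bs"
  unfolding pathwidth_def
proof (rule Min_le)
  have "pd_width bs \<in> {-1..int (card (pverts G))}" if "path_decomposition G bs" for bs
  proof -
    have "bs \<noteq> []" and sub: "\<And>B. B \<in> set bs \<Longrightarrow> B \<subseteq> pverts G"
      using that by (auto simp: path_decomposition_def)
    then have "Max ((\<lambda>B. int (card B)) ` set bs) \<in> (\<lambda>B. int (card B)) ` set bs"
      by (intro Max_in) auto
    then obtain B where "B \<in> set bs" "pd_width bs = int (card B) - 1"
      by (auto simp: pd_width_def)
    then show ?thesis
      using card_mono[OF assms(1) sub] by fastforce
  qed
  then show "finite (pd_width ` {bs. path_decomposition G bs})"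
    by (intro finite_subset[OF _ finite_atLeastAtMost_int]) blast
qed (use assms(2) in auto)

text \<open>The grid lives on a datatype, the final statement on natural numbers; an injective
  renaming bridges the two.\<close>

definition relabel :: "('a \<Rightarrow> 'b) \<Rightarrow> 'a pair_pre_digraph \<Rightarrow> 'b pair_pre_digraph" where
  "relabel f G = \<lparr>pverts = f ` pverts G, parcs = map_prod f f ` parcs G\<rparr>"

lemma pair_graphI:
  assumes "finite (pverts G)" and "parcs G \<subseteq> pverts G \<times> pverts G" and "irrefl (parcs G)" and "sym (parcs G)"
  shows "pair_graph G"
proof
  show "finite (parcs G)"
    using assms(1,2) by (meson finite_SigmaI finite_subset)
  show "symmetric (with_proj G)"
    using assms(4) by (simp add: symmetric_def)
qed (use assms in \<open>auto simp: irrefl_def\<close>)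

lemma pair_graph_relabel:
  assumes "pair_graph G" and "inj f"
  shows "pair_graph (relabel f G)"
proof -
  interpret pair_graph G
    by (rule assms(1))
  have "sym (parcs G)"
    using pair_sym_arcs by (simp add: symmetric_def)
  then have "sym (map_prod f f ` parcs G)"
    by (auto simp: sym_def)
  moreover have "irrefl (map_prod f f ` parcs G)"
    using pair_no_loops assms(2) by (force simp: irrefl_def inj_eq)
  moreover have "map_prod f f ` parcs G \<subseteq> f ` pverts G \<times> f ` pverts G"
    using in_arcsD1 in_arcsD2 by auto
  ultimately show ?thesis
    by (intro pair_graphI) (auto simp: relabel_def)
qed

text \<open>Bag \<open>t\<close> holds the vertices whose interval contains \<open>t\<close>. One
  inequality per arc suffices: arcs come in both directions, and two intervals meet if each starts
  no later than the other ends.\<close>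

lemma pathwidth_relabel_le_of_intervals:
  fixes l r :: "'a \<Rightarrow> nat"
  assumes G: "pair_graph G" and f: "inj f" and "0 < T"
    and lr: "\<And>v. v \<in> pverts G \<Longrightarrow> l v \<le> r v \<and> r v < T"
    and arcs: "\<And>u v. (u, v) \<in> parcs G \<Longrightarrow> l u \<le> r v"
    and bag: "\<And>t. t < T \<Longrightarrow> card {v \<in> pverts G. l v \<le> t \<and> t \<le> r v} \<le> Suc w"
  shows "pathwidth (relabel f G) \<le> int w"
proof -
  interpret pair_graph G
    by (rule G)
  define \<beta> where "\<beta> t = f ` {v \<in> pverts G. l v \<le> t \<and> t \<le> r v}" for t
  define bs where "bs = map \<beta> [0..<T]"
  have mem: "f v \<in> \<beta> t \<longleftrightarrow> v \<in> pverts G \<and> l v \<le> t \<and> t \<le> r v" for v t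
    using f by (auto simp: \<beta>_def inj_eq)
  have "path_decomposition (relabel f G) bs"
    unfolding path_decomposition_def
  proof (intro conjI ballI)
    show "bs \<noteq> []"
      using \<open>0 < T\<close> by (simp add: bs_def)
  next
    fix B assume "B \<in> set bs"
    then show "B \<subseteq> pverts (relabel f G)"
      by (auto simp: bs_def \<beta>_def relabel_def)
  next
    fix e assume "e \<in> parcs (relabel f G)"
    then obtain u v where e: "e = (f u, f v)" "(u, v) \<in> parcs G"
      by (auto simp: relabel_def)
    have uv: "u \<in> pverts G" "v \<in> pverts G"
      using in_arcsD1[OF e(2)] in_arcsD2[OF e(2)] by auto
    have "(v, u) \<in> parcs G"
      using e(2) pair_sym_arcs by (auto simp: symmetric_def sym_def)
    then have "f u \<in> \<beta> (max (l u) (l v))" "f v \<in> \<beta> (max (l u) (l v))"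
      using arcs e(2) lr uv by (auto simp: mem)
    moreover have "max (l u) (l v) < T"
      using lr[OF uv(1)] lr[OF uv(2)] by simp
    ultimately show "case e of (u, v) \<Rightarrow> \<exists>B \<in> set bs. u \<in> B \<and> v \<in> B"
      by (auto simp: e bs_def)
  next
    fix x assume "x \<in> pverts (relabel f G)"
    then obtain v where v: "x = f v" "v \<in> pverts G"
      by (auto simp: relabel_def)
    have "{t. t < length bs \<and> x \<in> bs ! t} = {l v..r v}"
      using lr[OF v(2)] v by (auto simp: bs_def mem)
    then show "\<exists>i j. i \<le> j \<and> j < length bs \<and> {t. t < length bs \<and> x \<in> bs ! t} = {i..j}"
      using lr[OF v(2)] by (auto simp: bs_def)
  qed
  then have "pathwidth (relabel f G) \<le> pd_width bs"
    by (rule pathwidth_le_pd_width[rotated]) (simp add: relabel_def)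
  also have "\<dots> \<le> int w"
  proof -
    have "int (card B) \<le> int w + 1" if B: "B \<in> set bs" for B
    proof -
      obtain t where "t < T" "B = \<beta> t"
        using B by (auto simp: bs_def)
      moreover have "card (\<beta> t) = card {v \<in> pverts G. l v \<le> t \<and> t \<le> r v}"
        unfolding \<beta>_def using f by (intro card_image) (auto simp: inj_on_def)
      ultimately show ?thesis
        using bag[of t] by simp
    qed
    then have "Max ((\<lambda>B. int (card B)) ` set bs) \<le> int w + 1"
      using \<open>0 < T\<close> by (subst Max_le_iff) (auto simp: bs_def)
    then show ?thesis
      by (simp add: pd_width_def)
  qed
  finally show ?thesis .
qed

section \<open>The grid of paths\<close>

datatype vertex = P nat nat | Q nat nat | R nat nat

instance vertex :: countable
  by countable_datatype

definition grid_verts :: "nat \<Rightarrow> nat \<Rightarrow> vertex set" where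
  "grid_verts k n = {P p i |p i. p < k \<and> i < 2 * n} \<union> {Q j i |j i. j < n \<and> i < 2 * k}
    \<union> {R p j |p j. p < k \<and> j < n}"

text \<open>Connectors are attached at even positions only. A path whose bit is one contributes its
  odd positions to \<open>grid_set\<close>, so \<open>R p j\<close> can be added when both bits are
  one.\<close>

definition grid_arcs :: "nat \<Rightarrow> nat \<Rightarrow> vertex rel" where
  "grid_arcs k n = {(P p i, P p (Suc i)) |p i. p < k \<and> Suc i < 2 * n}
    \<union> {(Q j i, Q j (Suc i)) |j i. j < n \<and> Suc i < 2 * k}
    \<union> {(R p j, P p (2 * j)) |p j. p < k \<and> j < n}
    \<union> {(R p j, Q j (2 * p)) |p j. p < k \<and> j < n}"

definition grid :: "nat \<Rightarrow> nat \<Rightarrow> vertex pair_pre_digraph" where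
  "grid k n = \<lparr>pverts = grid_verts k n, parcs = grid_arcs k n \<union> (grid_arcs k n)\<inverse>\<rparr>"

lemma grid_simps [simp]:
  "pverts (grid k n) = grid_verts k n"
  "parcs (grid k n) = grid_arcs k n \<union> (grid_arcs k n)\<inverse>"
  by (simp_all add: grid_def)

lemma grid_verts_image:
  "grid_verts k n = case_prod P ` ({..<k} \<times> {..<2 * n}) \<union> case_prod Q ` ({..<n} \<times> {..<2 * k})
    \<union> case_prod R ` ({..<k} \<times> {..<n})"
  by (auto simp: grid_verts_def image_iff)

lemma card_grid_verts: "card (grid_verts k n) \<le> 5 * (k * n)"
proof -
  have "card (grid_verts k n) \<le> card (case_prod P ` ({..<k} \<times> {..<2 * n}))
      + card (case_prod Q ` ({..<n} \<times> {..<2 * k})) + card (case_prod R ` ({..<k} \<times> {..<n}))"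
    unfolding grid_verts_image by (meson add_le_mono1 card_Un_le order_trans)
  also have "\<dots> \<le> card ({..<k} \<times> {..<2 * n}) + card ({..<n} \<times> {..<2 * k}) + card ({..<k} \<times> {..<n})"
    by (intro add_mono card_image_le) auto
  finally show ?thesis
    by simp
qed

lemma pair_graph_grid: "pair_graph (grid k n)"
proof (rule pair_graphI)
  show "finite (pverts (grid k n))"
    by (simp add: grid_verts_image)
  show "sym (parcs (grid k n))"
    by (simp add: sym_Un_converse)
  show "parcs (grid k n) \<subseteq> pverts (grid k n) \<times> pverts (grid k n)"
    by (auto simp: grid_arcs_def grid_verts_def)
  show "irrefl (parcs (grid k n))"
    by (auto simp: grid_arcs_def irrefl_def)
qed

text \<open>
  The path decomposition sweeps over the paths \<open>Q j\<close> one after the other. While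
  \<open>Q j\<close> is traversed, each path \<open>P p\<close> advances from \<open>P p (2 * j)\<close> to \<open>P p (2 * j + 2)\<close> directly after
  \<open>R p j\<close> has been passed. For \<open>j = 0\<close> the subtraction in \<open>grid_first\<close> truncates to the
  initial time.
\<close>

fun grid_first :: "nat \<Rightarrow> vertex \<Rightarrow> nat" where
  "grid_first k (P p i) = (if even i then i div 2 * Suc (2 * k) + Suc (2 * p) - Suc (2 * k)
     else i div 2 * Suc (2 * k) + Suc (2 * p))"
| "grid_first k (Q j i) = j * Suc (2 * k) + i"
| "grid_first k (R p j) = j * Suc (2 * k) + 2 * p"

fun grid_last :: "nat \<Rightarrow> vertex \<Rightarrow> nat" where
  "grid_last k (P p i) = i div 2 * Suc (2 * k) + Suc (2 * p)"
| "grid_last k (Q j i) = j * Suc (2 * k) + Suc i"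
| "grid_last k (R p j) = j * Suc (2 * k) + 2 * p"

lemma mult_add_le_mult:
  fixes m j L :: nat
  assumes "m < j"
  shows "m * L + L \<le> j * L"
  using mult_le_mono1[of "Suc m" j L] assms by simp

lemma mult_add_eq_iff:
  fixes m j L a s :: nat
  assumes "a < L" and "s < L"
  shows "m * L + a = j * L + s \<longleftrightarrow> m = j \<and> a = s"
proof -
  have "m = j" if "m * L + a = j * L + s"
    using that assms mult_add_le_mult[of m j L] mult_add_le_mult[of j m L]
    by (cases m j rule: linorder_cases) auto
  then show ?thesis
    by auto
qed

text \<open>\<open>R p j\<close> lives at a single moment, when \<open>Q j (2 * p)\<close> starts
  and \<open>P p (2 * j)\<close> is still alive. The next moment is shared by
  \<open>P p (2 * j)\<close> and its two successors on the path.\<close>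

lemma grid_arc_intervals:
  assumes "(u, v) \<in> grid_arcs k n"
  shows "grid_first k u \<le> grid_last k v \<and> grid_first k v \<le> grid_last k u"
  using assms unfolding grid_arcs_def
proof (elim UnE)
  assume "(u, v) \<in> {(P p i, P p (Suc i)) |p i. p < k \<and> Suc i < 2 * n}"
  then obtain p i where uv: "u = P p i" "v = P p (Suc i)"
    by auto
  show ?thesis
    unfolding uv by (cases "even i") (simp_all add: ac_simps)
qed auto

text \<open>Every \<open>P p\<close> has one current even vertex; only the path with
  \<open>2 * p + 1 = s\<close> is in transition and shows two more. Two vertices of
  \<open>Q j\<close> and one connector complete the \<open>k + 5\<close>. For \<open>s = 0\<close>
  the truncated \<open>s - 1\<close> only enlarges the superset.\<close>

lemma grid_bag:
  fixes k j s :: nat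
  defines "L \<equiv> Suc (2 * k)"
  assumes s: "s < L"
  shows "{v \<in> grid_verts k n. grid_first k v \<le> j * L + s \<and> j * L + s \<le> grid_last k v}
    \<subseteq> (\<lambda>p. P p (if s \<le> Suc (2 * p) then 2 * j else 2 * j + 2)) ` {..<k}
      \<union> {P ((s - 1) div 2) (2 * j + 1), P ((s - 1) div 2) (2 * j + 2),
          Q j s, Q j (s - 1), R (s div 2) j}" (is "_ \<subseteq> ?B")
proof (intro subsetI UnCI)
  fix v assume "v \<in> {v \<in> grid_verts k n. grid_first k v \<le> j * L + s \<and> j * L + s \<le> grid_last k v}"
  then have v: "v \<in> grid_verts k n" and fl: "grid_first k v \<le> j * L + s" "j * L + s \<le> grid_last k v"
    by auto
  assume nin: "v \<notin> {P ((s - 1) div 2) (2 * j + 1), P ((s - 1) div 2) (2 * j + 2),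
          Q j s, Q j (s - 1), R (s div 2) j}"
  have parity: "i = 2 * (i div 2) \<or> i = 2 * (i div 2) + 1" for i :: nat
    by linarith
  from v consider (even) p m where "v = P p (2 * m)" "p < k" | (odd) p m where "v = P p (2 * m + 1)" "p < k"
    | (Q) j' i where "v = Q j' i" "i < 2 * k" | (R) p j' where "v = R p j'" "p < k"
    using parity unfolding grid_verts_def by blast
  then show "v \<in> (\<lambda>p. P p (if s \<le> Suc (2 * p) then 2 * j else 2 * j + 2)) ` {..<k}"
  proof cases
    case even
    have 1: "m * L + Suc (2 * p) \<le> j * L + s + L" and 2: "j * L + s \<le> m * L + Suc (2 * p)"
      using fl by (simp_all add: even L_def)
    have p: "Suc (2 * p) < L"
      using even by (simp add: L_def)
    have "\<not> m < j"
      using mult_add_le_mult[of m j L] 2 p by linarith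
    moreover have "\<not> Suc j < m"
      using mult_add_le_mult[of "Suc j" m L] 1 s by auto
    ultimately consider "m = j" | "m = Suc j"
      by linarith
    then show ?thesis
    proof cases
      case 1
      then show ?thesis
        using 2 even by auto
    next
      case 2
      then have "Suc (2 * p) \<le> s"
        using 1 by simp
      moreover have "s \<noteq> Suc (2 * p)"
        using nin 2 even by auto
      ultimately show ?thesis
        using 2 even by auto
    qed
  next
    case odd
    have "m * L + Suc (2 * p) = j * L + s"
      using fl by (simp add: odd L_def)
    then have "m = j \<and> Suc (2 * p) = s"
      using odd by (subst (asm) mult_add_eq_iff[OF _ s]) (auto simp: L_def)
    then show ?thesis
      using nin odd by auto
  next
    case Q
    have "j' * L + i = j * L + s \<or> j' * L + Suc i = j * L + s"
      using fl by (auto simp: Q L_def)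
    moreover have "i < L" "Suc i < L"
      using Q by (simp_all add: L_def)
    ultimately have "j' = j \<and> (i = s \<or> Suc i = s)"
      using s by (auto simp only: mult_add_eq_iff)
    then show ?thesis
      using nin Q by auto
  next
    case R
    have "j' * L + 2 * p = j * L + s"
      using fl by (simp add: R L_def)
    then have "j' = j \<and> 2 * p = s"
      using R by (subst (asm) mult_add_eq_iff[OF _ s]) (auto simp: L_def)
    then show ?thesis
      using nin R by auto
  qed
qed

lemma pathwidth_relabel_grid:
  fixes f :: "vertex \<Rightarrow> 'a"
  assumes "inj f" and "0 < n"
  shows "pathwidth (relabel f (grid k n)) \<le> int (k + 4)"
proof (rule pathwidth_relabel_le_of_intervals[where T = "n * Suc (2 * k)"
    and l = "grid_first k" and r = "grid_last k"])
  let ?L = "Suc (2 * k)"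
  show "0 < n * ?L"
    using assms(2) by simp
  show "grid_first k v \<le> grid_last k v \<and> grid_last k v < n * ?L" if "v \<in> pverts (grid k n)" for v
  proof -
    have *: "j * ?L + a < n * ?L" if "j < n" "a < ?L" for j a
      using mult_add_le_mult[OF that(1), of ?L] that(2) by linarith
    from that consider (P) p i where "v = P p i" "p < k" "i div 2 < n"
      | (Q) j i where "v = Q j i" "j < n" "i < 2 * k" | (R) p j where "v = R p j" "p < k" "j < n"
      by (auto simp: grid_verts_def less_mult_imp_div_less)
    then have "grid_last k v < n * ?L"
    proof cases
      case P
      then show ?thesis
        using *[of "i div 2" "Suc (2 * p)"] by simp
    next
      case Q
      then show ?thesis
        using *[of j "Suc i"] by simp
    next
      case R
      then show ?thesis
        using *[of j "2 * p"] by simp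
    qed
    moreover have "grid_first k v \<le> grid_last k v"
      by (cases v) auto
    ultimately show ?thesis
      by simp
  qed
  show "grid_first k u \<le> grid_last k v" if "(u, v) \<in> parcs (grid k n)" for u v
    using that grid_arc_intervals[of u v k n] grid_arc_intervals[of v u k n] by auto
  show "card {v \<in> pverts (grid k n). grid_first k v \<le> t \<and> t \<le> grid_last k v} \<le> Suc (k + 4)" for t
  proof -
    let ?j = "t div ?L" and ?s = "t mod ?L"
    let ?A = "(\<lambda>p. P p (if ?s \<le> Suc (2 * p) then 2 * ?j else 2 * ?j + 2)) ` {..<k}"
    let ?B = "{P ((?s - 1) div 2) (2 * ?j + 1), P ((?s - 1) div 2) (2 * ?j + 2),
      Q ?j ?s, Q ?j (?s - 1), R (?s div 2) ?j}"
    have "{v \<in> pverts (grid k n). grid_first k v \<le> t \<and> t \<le> grid_last k v} \<subseteq> ?A \<union> ?B"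
      using grid_bag[of ?s k n ?j] unfolding grid_simps div_mult_mod_eq by simp
    then have "card {v \<in> pverts (grid k n). grid_first k v \<le> t \<and> t \<le> grid_last k v} \<le> card (?A \<union> ?B)"
      by (rule card_mono[rotated]) simp
    also have "\<dots> \<le> card ?A + card ?B"
      by (rule card_Un_le)
    also have "card ?A \<le> k"
      using card_image_le[of "{..<k}"] by simp
    also have "card ?B \<le> 5"
      by (intro card_insert_le_m1) auto
    finally show ?thesis
      by simp
  qed
qed (use assms pair_graph_grid in auto)

section \<open>Independent sets chosen by bits\<close>

definition grid_set :: "nat \<Rightarrow> nat \<Rightarrow> nat set \<Rightarrow> nat set \<Rightarrow> vertex set" where
  "grid_set k n x y = {P p i |p i. p < k \<and> i < 2 * n \<and> (p \<in> x \<longleftrightarrow> odd i)}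
    \<union> {Q j i |j i. j < n \<and> i < 2 * k \<and> (j \<in> y \<longleftrightarrow> odd i)}
    \<union> {R p j |p j. p < k \<and> j < n \<and> p \<in> x \<and> j \<in> y}"

lemma grid_set_simps [simp]:
  "P p i \<in> grid_set k n x y \<longleftrightarrow> p < k \<and> i < 2 * n \<and> (p \<in> x \<longleftrightarrow> odd i)"
  "Q j i \<in> grid_set k n x y \<longleftrightarrow> j < n \<and> i < 2 * k \<and> (j \<in> y \<longleftrightarrow> odd i)"
  "R p j \<in> grid_set k n x y \<longleftrightarrow> p < k \<and> j < n \<and> p \<in> x \<and> j \<in> y"
  by (auto simp: grid_set_def)

lemma grid_set_independent: "grid_set k n x y \<in> independent_sets (grid k n)"
proof -
  have "\<not> (u \<in> grid_set k n x y \<and> v \<in> grid_set k n x y)" if "(u, v) \<in> grid_arcs k n" for u v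
    using that by (auto simp: grid_arcs_def)
  then show ?thesis
    by (fastforce simp: independent_sets_def grid_set_def grid_verts_def)
qed

text \<open>These vertices carry the weight: for \<open>k\<close> at least 1, either colour class of
  \<open>Q j\<close> contains exactly one of its first two vertices, so all chosen sets weigh
  \<open>n\<close>, one unit per \<open>Q j\<close>.\<close>

definition first_pairs :: "nat \<Rightarrow> vertex set" where
  "first_pairs n = {Q j i |j i. j < n \<and> i < 2}"

lemma grid_set_first_pairs:
  assumes "1 \<le> k"
  shows "grid_set k n x y \<inter> first_pairs n = (\<lambda>j. Q j (if j \<in> y then 1 else 0)) ` {..<n}"
  using assms by (auto simp: first_pairs_def less_2_cases_iff image_iff split: if_splits)

lemma card_grid_set_first_pairs:
  assumes "1 \<le> k"
  shows "card (grid_set k n x y \<inter> first_pairs n) = n"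
  unfolding grid_set_first_pairs[OF assms] by (subst card_image) (auto intro: inj_onI)

section \<open>Separations of the grid\<close>

text \<open>As no arc joins \<open>A\<close> and \<open>B\<close>, membership in \<open>A\<close>
  passes between consecutive vertices in both directions.\<close>

lemma path_on_one_side:
  fixes f :: "nat \<Rightarrow> 'v"
  assumes "\<And>u v. u \<in> A \<Longrightarrow> v \<in> B \<Longrightarrow> (u, v) \<notin> E" and "sym E"
    and "\<And>i. Suc i < m \<Longrightarrow> (f i, f (Suc i)) \<in> E"
    and "\<And>i. i < m \<Longrightarrow> f i \<in> A \<union> B"
    and "i < m" and "f i \<in> A" and "j < m"
  shows "f j \<in> A"
proof -
  have step: "f i \<in> A \<longleftrightarrow> f (Suc i) \<in> A" if "Suc i < m" for i
    using assms(1)[of "f i" "f (Suc i)"] assms(1)[of "f (Suc i)" "f i"] assms(3)[OF that]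
      symD[OF assms(2) assms(3)[OF that]] assms(4)[of i] assms(4)[of "Suc i"] that by auto
  have "i < m \<Longrightarrow> f i \<in> A \<longleftrightarrow> f 0 \<in> A" for i
    by (induction i) (use step in auto)
  then show ?thesis
    using assms(5-7) by blast
qed

lemma card_subsets_avoiding:
  assumes "J \<subseteq> {..<n :: nat}"
  shows "card (Pow ({..<n} - J)) = 2 ^ (n - card J)"
  using assms by (simp add: card_Pow card_Diff_subset finite_subset)

definition balanced_choices :: "nat \<Rightarrow> nat \<Rightarrow> vertex set \<Rightarrow> vertex set \<Rightarrow> (nat set \<times> nat set) set" where
  "balanced_choices k n A B = {(x, y) \<in> Pow {..<k} \<times> Pow {..<n}. grid_set k n x y \<subseteq> A \<union> B
    \<and> n \<le> 3 * card (grid_set k n x y \<inter> first_pairs n \<inter> A)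
    \<and> n \<le> 3 * card (grid_set k n x y \<inter> first_pairs n \<inter> B)}"

text \<open>
  If the separation misses \<open>P p\<close> and few of its connectors, then the path lies on one side
  together with each \<open>Q j\<close> that is missed as well. Balance hence forces many \<open>Q j\<close> to
  be hit, and each of these fixes whether \<open>j \<in> y\<close>.
\<close>

lemma card_balanced_choices_connected:
  assumes k: "1 \<le> k" and n: "n = 9 * k" and "A \<inter> B = {}"
    and sep: "\<And>u v. u \<in> A \<Longrightarrow> v \<in> B \<Longrightarrow> (u, v) \<notin> parcs (grid k n)"
    and p: "p < k" and clean: "\<And>i. i < 2 * n \<Longrightarrow> P p i \<in> A \<union> B" and A: "P p 0 \<in> A"
    and few: "card {j. j < n \<and> R p j \<notin> A \<union> B} < 2 * k"
  shows "card (balanced_choices k n A B) \<le> 2 ^ n"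
proof (cases "balanced_choices k n A B = {}")
  case False
  define J where "J = {j. j < n \<and> R p j \<notin> A \<union> B}"
  define D where "D = {j. j < n \<and> (\<exists>i<2 * k. Q j i \<notin> A \<union> B)}"
  \<comment> \<open>A hit vertex must not be chosen: an even one forces the bit of
    \<open>Q j\<close> to be one, an odd one forces zero. So \<open>y0\<close> is the only possible
    trace of \<open>y\<close> on \<open>D\<close>.\<close>
  define y0 where "y0 = {j \<in> D. \<exists>i<2 * k. even i \<and> Q j i \<notin> A \<union> B}"
  have sym: "sym (parcs (grid k n))"
    by (simp add: sym_Un_converse)
  have P_in_A: "P p i \<in> A" if "i < 2 * n" for i
    by (rule path_on_one_side[where f = "P p" and m = "2 * n", OF sep sym _ clean _ A that])
      (use p k n in \<open>auto simp: grid_arcs_def\<close>)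
  \<comment> \<open>The connector \<open>R p j\<close> carries the side of \<open>P p\<close> over
    to \<open>Q j\<close>.\<close>
  have Q_in_A: "Q j i \<in> A" if j: "j < n" "j \<notin> J \<union> D" and i: "i < 2 * k" for j i
  proof (rule path_on_one_side[where f = "Q j" and m = "2 * k", OF sep sym _ _ _ _ i])
    have arcs: "(P p (2 * j), R p j) \<in> parcs (grid k n)" "(R p j, Q j (2 * p)) \<in> parcs (grid k n)"
      using j p by (auto simp: grid_arcs_def)
    have "R p j \<in> A"
      using sep[of "P p (2 * j)" "R p j"] arcs(1) P_in_A[of "2 * j"] j by (auto simp: J_def)
    moreover have "Q j (2 * p) \<in> A \<union> B"
      using j p by (simp add: D_def)
    ultimately show "Q j (2 * p) \<in> A"
      using sep[of "R p j" "Q j (2 * p)"] arcs(2) by blast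
  qed (use j p in \<open>auto simp: D_def grid_arcs_def\<close>)
  have fin: "finite J" "finite D" and D: "D \<subseteq> {..<n}"
    by (auto simp: J_def D_def)
  \<comment> \<open>One balanced choice suffices to show that \<open>D\<close> is large, since
    \<open>D\<close> depends on the separation only.\<close>
  obtain x y where xy: "(x, y) \<in> balanced_choices k n A B"
    using False by auto
  have "grid_set k n x y \<inter> first_pairs n \<inter> B \<subseteq> (\<lambda>j. Q j (if j \<in> y then 1 else 0)) ` (J \<union> D)"
  proof
    fix v assume v: "v \<in> grid_set k n x y \<inter> first_pairs n \<inter> B"
    then obtain j where j: "v = Q j (if j \<in> y then 1 else 0)" "j < n"
      unfolding grid_set_first_pairs[OF k] by auto
    have "j \<in> J \<union> D"
      using Q_in_A[of j "if j \<in> y then 1 else 0"] v j k \<open>A \<inter> B = {}\<close> by (auto split: if_splits)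
    then show "v \<in> (\<lambda>j. Q j (if j \<in> y then 1 else 0)) ` (J \<union> D)"
      using j by auto
  qed
  then have "card (grid_set k n x y \<inter> first_pairs n \<inter> B) \<le> card (J \<union> D)"
    by (rule surj_card_le[rotated]) (use fin in simp)
  also have "\<dots> \<le> card J + card D"
    by (rule card_Un_le)
  \<comment> \<open>Balance puts at least \<open>n / 3 = 3 * k\<close> units into \<open>B\<close>,
    and fewer than \<open>2 * k\<close> of them are due to \<open>J\<close>.\<close>
  finally have "k \<le> card D"
    using few xy unfolding J_def[symmetric] by (auto simp: balanced_choices_def n)
  have "balanced_choices k n A B \<subseteq> Pow {..<k} \<times> (\<lambda>z. z \<union> y0) ` Pow ({..<n} - D)"
  proof (rule subrelI)
    fix x y assume "(x, y) \<in> balanced_choices k n A B"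
    then have xy: "x \<subseteq> {..<k}" "y \<subseteq> {..<n}" "grid_set k n x y \<subseteq> A \<union> B"
      by (auto simp: balanced_choices_def)
    have Q_notin: "\<not> (j \<in> y \<longleftrightarrow> odd i)" if "j < n" "i < 2 * k" "Q j i \<notin> A \<union> B" for j i
      using that xy(3) by (metis grid_set_simps(2) subsetD)
    have "y \<inter> D = y0"
      using Q_notin unfolding y0_def D_def by blast
    then have "y = (y - D) \<union> y0"
      by blast
    then show "(x, y) \<in> Pow {..<k} \<times> (\<lambda>z. z \<union> y0) ` Pow ({..<n} - D)"
      using xy by blast
  qed
  then have "card (balanced_choices k n A B)
      \<le> card (Pow {..<k} \<times> (\<lambda>z. z \<union> y0) ` Pow ({..<n} - D))"
    by (rule card_mono[rotated]) simp
  also have "\<dots> \<le> 2 ^ k * 2 ^ (n - card D)"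
    unfolding card_cartesian_product card_subsets_avoiding[OF D, symmetric]
    by (intro mult_mono card_image_le) (simp_all add: card_Pow)
  also have "\<dots> = 2 ^ (k + (n - card D))"
    by (simp add: power_add)
  also have "\<dots> \<le> 2 ^ n"
    using \<open>k \<le> card D\<close> card_mono[OF _ D] by (intro power_increasing) auto
  finally show ?thesis .
qed simp

text \<open>
  If every path \<open>P p\<close> is hit or has many connectors hit, then \<open>y\<close> determines \<open>x\<close>, unless \<open>y\<close>
  avoids all the hit connectors of some \<open>P p\<close>, which happens for a small fraction of the
  sets \<open>y\<close> only.
\<close>

lemma card_balanced_choices_disconnected:
  assumes n: "2 * k \<le> n"
    and many: "\<And>p. p < k \<Longrightarrow> (\<And>i. i < 2 * n \<Longrightarrow> P p i \<in> A \<union> B) \<Longrightarrow>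
      2 * k \<le> card {j. j < n \<and> R p j \<notin> A \<union> B}"
  shows "card (balanced_choices k n A B) \<le> 2 * 2 ^ n"
proof -
  define J where "J p = {j. j < n \<and> R p j \<notin> A \<union> B}" for p
  define clean where "clean = {p. p < k \<and> (\<forall>i<2 * n. P p i \<in> A \<union> B)}"
  \<comment> \<open>The forced bits: a hit vertex fixes the bit of its path by parity, and a clean
    path must have bit zero as soon as \<open>y\<close> meets one of its hit connectors.\<close>
  define x0 where "x0 = {p. p < k \<and> (\<exists>i<2 * n. even i \<and> P p i \<notin> A \<union> B)}"
  define bad where "bad = (\<Union>p\<in>clean. Pow ({..<n} - J p))"
  have J: "J p \<subseteq> {..<n}" for p
    by (auto simp: J_def)
  have "balanced_choices k n A B \<subseteq> {x0} \<times> Pow {..<n} \<union> Pow {..<k} \<times> bad"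
  proof (rule subrelI)
    fix x y assume "(x, y) \<in> balanced_choices k n A B"
    then have xy: "x \<subseteq> {..<k}" "y \<subseteq> {..<n}" "grid_set k n x y \<subseteq> A \<union> B"
      by (auto simp: balanced_choices_def)
    have P_notin: "\<not> (p \<in> x \<longleftrightarrow> odd i)" if "p < k" "i < 2 * n" "P p i \<notin> A \<union> B" for p i
      using that xy(3) by (metis grid_set_simps(1) subsetD)
    have "x = x0" if bad: "y \<notin> bad"
    proof -
      have "p \<notin> x" if p: "p \<in> clean" for p
      proof
        assume "p \<in> x"
        obtain j where "j \<in> y" "j \<in> J p"
          using xy(2) bad p unfolding bad_def by blast
        moreover from this have "R p j \<in> grid_set k n x y"
          using \<open>p \<in> x\<close> p by (auto simp: clean_def J_def)
        ultimately show False
          using xy(3) unfolding J_def by blast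
      qed
      then show ?thesis
        using xy(1) P_notin unfolding x0_def clean_def by blast
    qed
    then show "(x, y) \<in> {x0} \<times> Pow {..<n} \<union> Pow {..<k} \<times> bad"
      using xy(1,2) by blast
  qed
  moreover have "finite bad"
    by (auto simp: bad_def clean_def)
  ultimately have "card (balanced_choices k n A B) \<le> card ({x0} \<times> Pow {..<n} \<union> Pow {..<k} \<times> bad)"
    by (intro card_mono) auto
  also have "\<dots> \<le> 2 ^ n + 2 ^ k * card bad"
    by (rule order_trans[OF card_Un_le]) (simp add: card_cartesian_product card_Pow)
  finally have le: "card (balanced_choices k n A B) \<le> 2 ^ n + 2 ^ k * card bad" .
  have "card bad \<le> (\<Sum>p\<in>clean. card (Pow ({..<n} - J p)))"
    unfolding bad_def by (rule card_UN_le) (simp add: clean_def)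
  also have "\<dots> \<le> (\<Sum>p\<in>clean. 2 ^ (n - 2 * k))"
  proof (rule sum_mono)
    fix p assume "p \<in> clean"
    then have "2 * k \<le> card (J p)"
      using many[of p] by (simp add: clean_def J_def)
    then show "card (Pow ({..<n} - J p)) \<le> 2 ^ (n - 2 * k)"
      unfolding card_subsets_avoiding[OF J] by (intro power_increasing) auto
  qed
  also have "\<dots> \<le> 2 ^ k * 2 ^ (n - 2 * k)"
  proof -
    have "card clean \<le> k"
      using card_mono[of "{..<k}" clean] by (auto simp: clean_def)
    then have "card clean \<le> 2 ^ k"
      using less_exp[of k] by linarith
    then show ?thesis
      by simp
  qed
  \<comment> \<open>The threshold \<open>2 * k\<close> pays for two factors \<open>2 ^ k\<close>:
    the free choice of \<open>x\<close>, and the union over at most \<open>k\<close> clean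
    paths.\<close>
  finally have "2 ^ k * card bad \<le> 2 ^ k * (2 ^ k * 2 ^ (n - 2 * k))"
    by (rule mult_le_mono2)
  also have "\<dots> = 2 ^ n"
    using n by (simp flip: power_add add: mult_2)
  finally show ?thesis
    using le by simp
qed

lemma balanced_choices_commute: "balanced_choices k n A B = balanced_choices k n B A"
  by (auto simp: balanced_choices_def Un_commute)

lemma card_balanced_choices:
  assumes k: "1 \<le> k" and n: "n = 9 * k" and disj: "A \<inter> B = {}"
    and sep: "\<And>u v. u \<in> A \<Longrightarrow> v \<in> B \<Longrightarrow> (u, v) \<notin> parcs (grid k n)"
  shows "card (balanced_choices k n A B) \<le> 2 * 2 ^ n"
proof (cases "\<exists>p<k. (\<forall>i<2 * n. P p i \<in> A \<union> B) \<and> card {j. j < n \<and> R p j \<notin> A \<union> B} < 2 * k")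
  case True
  then obtain p where p: "p < k" "\<And>i. i < 2 * n \<Longrightarrow> P p i \<in> A \<union> B"
    "card {j. j < n \<and> R p j \<notin> A \<union> B} < 2 * k"
    by blast
  have "P p 0 \<in> A \<union> B"
    using p(2) k n by simp
  then have "card (balanced_choices k n A B) \<le> 2 ^ n"
  proof
    assume "P p 0 \<in> A"
    then show ?thesis
      using card_balanced_choices_connected[OF k n disj sep p(1,2) _ p(3)] by blast
  next
    \<comment> \<open>The situation is symmetric, so the connected case applies with
      \<open>A\<close> and \<open>B\<close> exchanged.\<close>
    assume *: "P p 0 \<in> B"
    have "(v, u) \<notin> parcs (grid k n)" if "v \<in> B" "u \<in> A" for u v
      using sep[OF that(2,1)] by auto
    note sep' = this
    show ?thesis
      unfolding balanced_choices_commute[of k n A B]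
      by (intro card_balanced_choices_connected[OF k n _ sep' p(1) _ *])
        (use p(2,3) disj in \<open>simp_all add: Int_commute Un_commute\<close>)
  qed
  then show ?thesis
    by simp
next
  case False
  show ?thesis
  proof (rule card_balanced_choices_disconnected)
    fix p assume "p < k" and "\<And>i. i < 2 * n \<Longrightarrow> P p i \<in> A \<union> B"
    then have "\<not> card {j. j < n \<and> R p j \<notin> A \<union> B} < 2 * k"
      using False by blast
    then show "2 * k \<le> card {j. j < n \<and> R p j \<notin> A \<union> B}"
      by simp
  qed (use n in simp)
qed

section \<open>The lower bound on the circuit size\<close>

text \<open>There are \<open>2 ^ (k + n)\<close> choices of bits and, pulled back along
  \<open>f\<close>, the separation of a node catches at most \<open>2 * 2 ^ n\<close> of
  them.\<close>

lemma relabel_grid_circuit_size: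
  fixes f :: "vertex \<Rightarrow> 'v" and C :: "('v, 'n) circuit"
  assumes k: "1 \<le> k" and n: "n = 9 * k" and f: "inj f"
    and C: "tropical_circuit (pverts (relabel f (grid k n))) C"
      "calculates C (IS_poly (relabel f (grid k n)))"
  shows "2 ^ k \<le> 2 * circuit_size C"
proof -
  let ?\<Omega> = "Pow {..<k} \<times> Pow {..<n}"
  let ?I = "\<lambda>(x, y). f ` grid_set k n x y"
  have "card ?\<Omega> \<le> circuit_size C * (2 * 2 ^ n)"
  proof (rule circuit_size_ge_of_separations[OF pair_graph_relabel[OF pair_graph_grid f] C])
    show "?I \<omega> \<in> independent_sets (relabel f (grid k n))" for \<omega>
    proof -
      obtain x y where \<omega>: "\<omega> = (x, y)"
        by fastforce
      show ?thesis
        using grid_set_independent[of k n x y] f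
        by (auto simp: independent_sets_def relabel_def \<omega> inj_eq)
    qed
    show "card (?I \<omega> \<inter> f ` first_pairs n) = n" for \<omega>
    proof -
      obtain x y where \<omega>: "\<omega> = (x, y)"
        by fastforce
      have "f ` grid_set k n x y \<inter> f ` first_pairs n = f ` (grid_set k n x y \<inter> first_pairs n)"
        using f by (simp add: image_Int)
      then show ?thesis
        using card_grid_set_first_pairs[OF k, of n x y] f by (simp add: \<omega> card_image inj_on_subset)
    qed
    fix A B :: "'v set" assume disj: "A \<inter> B = {}"
      and sep: "\<And>u v. u \<in> A \<Longrightarrow> v \<in> B \<Longrightarrow> (u, v) \<notin> parcs (relabel f (grid k n))"
    have card: "card (f ` S \<inter> f ` W \<inter> X) = card (S \<inter> W \<inter> f -` X)" for S W X
    proof -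
      have "f ` S \<inter> f ` W \<inter> X = f ` (S \<inter> W \<inter> f -` X)"
        using f by (auto simp: inj_eq)
      then show ?thesis
        using f by (simp add: card_image inj_on_subset)
    qed
    have "{\<omega> \<in> ?\<Omega>. ?I \<omega> \<subseteq> A \<union> B \<and> n \<le> 3 * card (?I \<omega> \<inter> f ` first_pairs n \<inter> A)
        \<and> n \<le> 3 * card (?I \<omega> \<inter> f ` first_pairs n \<inter> B)} = balanced_choices k n (f -` A) (f -` B)"
      by (auto simp: balanced_choices_def card)
    also have "card \<dots> \<le> 2 * 2 ^ n"
    proof (rule card_balanced_choices[OF k n])
      show "f -` A \<inter> f -` B = {}"
        using disj by auto
      show "(u, v) \<notin> parcs (grid k n)" if "u \<in> f -` A" "v \<in> f -` B" for u v
        using sep[of "f u" "f v"] that by (force simp: relabel_def)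
    qed
    finally show "card {\<omega> \<in> ?\<Omega>. ?I \<omega> \<subseteq> A \<union> B \<and> n \<le> 3 * card (?I \<omega> \<inter> f ` first_pairs n \<inter> A)
        \<and> n \<le> 3 * card (?I \<omega> \<inter> f ` first_pairs n \<inter> B)} \<le> 2 * 2 ^ n" .
  qed (use k n in auto)
  then have "2 ^ k * 2 ^ n \<le> (2 * circuit_size C) * 2 ^ n"
    by (simp add: card_cartesian_product card_Pow ac_simps)
  then show ?thesis
    by simp
qed

theorem theorem1p1:
  shows "\<exists>c > (0 :: real). \<exists>d > (0 :: real). \<forall>k :: nat. k \<ge> 1 \<longrightarrow>
    (\<exists>G :: nat pair_pre_digraph.
       pair_graph G \<and> pathwidth G \<le> int k \<and> real (card (pverts G)) \<le> real k powr c \<and>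
       (\<forall>C :: (nat, nat) circuit.
          tropical_circuit (pverts G) C \<and> calculates C (IS_poly G) \<longrightarrow>
          d * 2 ^ k \<le> real (circuit_size C)))"
\<comment> \<open>The sweep adds 4 to the pathwidth, so the grid is built for \<open>k - 4\<close>.
  This loses a factor 16 and the bound per node another 2, whence 1/32.\<close>
proof (rule exI[of _ 5], intro conjI, simp, rule exI[of _ "1 / 32"], intro conjI allI impI)
  fix k :: nat assume k: "1 \<le> k"
  show "\<exists>G :: nat pair_pre_digraph.
    pair_graph G \<and> pathwidth G \<le> int k \<and> real (card (pverts G)) \<le> real k powr 5 \<and>
    (\<forall>C :: (nat, nat) circuit.
      tropical_circuit (pverts G) C \<and> calculates C (IS_poly G) \<longrightarrow>
      1 / 32 * 2 ^ k \<le> real (circuit_size C))"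
  \<comment> \<open>For \<open>k\<close> up to 4 the empty graph does: a circuit has at least one
    node, and \<open>2 ^ 4 / 32\<close> is below 1.\<close>
  proof (cases "k \<le> 4")
    case True
    let ?G = "\<lparr>pverts = {}, parcs = {}\<rparr> :: nat pair_pre_digraph"
    have "pair_graph ?G"
      by (rule pair_graphI) (auto simp: irrefl_def sym_def)
    moreover have "pathwidth ?G \<le> int k"
      using pathwidth_le_pd_width[of ?G "[{}]"] by (simp add: path_decomposition_def pd_width_def)
    moreover have "1 / 32 * 2 ^ k \<le> real (circuit_size C)"
      if "tropical_circuit (pverts ?G) C" for C :: "(nat, nat) circuit"
    proof -
      have "circuit_size C \<noteq> 0"
        using that by (auto simp: tropical_circuit_def circuit_size_def)
      moreover have "(2 :: real) ^ k \<le> 2 ^ 4"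
        using True by (intro power_increasing) auto
      ultimately show ?thesis
        by simp
    qed
    ultimately show ?thesis
      by (intro exI[of _ ?G]) auto
  next
    case False
    define m where "m = k - 4"
    have m: "1 \<le> m" and k_eq: "k = m + 4"
      using False by (simp_all add: m_def)
    let ?f = "to_nat :: vertex \<Rightarrow> nat"
    let ?G = "relabel ?f (grid m (9 * m))"
    have "pair_graph ?G"
      by (intro pair_graph_relabel pair_graph_grid) simp
    moreover have "pathwidth ?G \<le> int k"
      using pathwidth_relabel_grid[of ?f "9 * m" m] m by (simp add: k_eq)
    moreover have "real (card (pverts ?G)) \<le> real k powr 5"
    proof -
      have "card (pverts ?G) \<le> card (grid_verts m (9 * m))"
        by (simp add: relabel_def card_image)
      also have "\<dots> \<le> 45 * m ^ 2"
        using card_grid_verts[of m "9 * m"] by (simp add: power2_eq_square)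
      \<comment> \<open>Here \<open>k\<close> is at least 5, so \<open>k ^ 3\<close> absorbs the
        constant 45; this gives the exponent 5.\<close>
      also have "\<dots> \<le> k ^ 3 * k ^ 2"
      proof (rule mult_mono)
        have "(5 :: nat) ^ 3 \<le> k ^ 3"
          using False by (intro power_mono) auto
        then show "45 \<le> k ^ 3"
          by simp
        show "m ^ 2 \<le> k ^ 2"
          by (intro power_mono) (simp_all add: k_eq)
      qed auto
      also have "\<dots> = k ^ 5"
        by (simp flip: power_add)
      finally have "real (card (pverts ?G)) \<le> real (k ^ 5)"
        by (rule of_nat_mono)
      then show ?thesis
        using k by simp
    qed
    moreover have "1 / 32 * 2 ^ k \<le> real (circuit_size C)"
      if "tropical_circuit (pverts ?G) C" "calculates C (IS_poly ?G)" for C :: "(nat, nat) circuit"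
    proof -
      have "2 ^ m \<le> 2 * circuit_size C"
        using relabel_grid_circuit_size[OF m refl _ that] by simp
      then have "real (2 ^ m) \<le> real (2 * circuit_size C)"
        by (rule of_nat_mono)
      then show ?thesis
        by (simp add: k_eq power_add)
    qed
    ultimately show ?thesis
      by blast
  qed
qed simp

end
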